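(* Let $X$ be a quasi-Banach function lattice over a metric measure space $(\mathcal P,d,\mu)$. The space $N^1X$ is a lattice, i.e., if $u,v\in N^1X$, then $\max\{u,v\},\ \min\{u,v\},\ |u|,\ u^+,\ u^-\in N^1X$.
   Context: Standing setting: $(\mathcal P,d)$ is a metric space with a $\sigma$-finite Borel regular measure $\mu$ (Borel sets are $\mu$-measurable, and each $\mu$-measurable set $A$ is contained in a Borel set $D$ with $\mu(D)=\mu(A)$), such that every ball has finite positive measure. $\mathcal M(\mathcal P,\mu)$ is the set of extended real-valued $\mu$-measurable functions on $\mathcal P$ (defined everywhere). A quasi-Banach function lattice $X$ is given by a functional $\|\cdot\|_X:\mathcal M(\mathcal P,\mu)\to[0,\infty]$ with $X=\{u\in\mathcal M(\mathcal P,\mu):\|u\|_X<\infty\}$ such that, for some constant $c\ge1$ (the modulus of concavity): (i) $\|u\|_X=0$ iff $u=0$ a.e.; $\|au\|_X=|a|\,\|u\|_X$ for $a\in\mathbb R$; $\|u+v\|_X\le c(\|u\|_X+\|v\|_X)$; (ii) $|u|\le|v|$ a.e. implies $\|u\|_X\le\|v\|_X$; (iii) (Riesz–Fischer) if $u_n\ge0$ a.e. for all $n\ge 1$, then $\bigl\|\sum_{n=1}^\infty u_n\bigr\|_X\le\sum_{n=1}^\infty c^n\|u_n\|_X$. Moreover, $\|\cdot\|_X$ is assumed continuous: $\|u_n-u\|_X\to0$ implies $\|u_n\|_X\to\|u\|_X$. Elements of $X$ are functions defined everywhere, not a.e. equivalence classes. A curve is a non-constant rectifiable continuous map from a compact interval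 to $\mathcal P$, always parametrized by arc length, $\gamma:[0,l_\gamma]\to\mathcal P$. A Borel function $g:\mathcal P\to[0,\infty]$ is an upper gradient of $u:\mathcal P\to\overline{\mathbb R}=\mathbb{R}\cup\{\pm\infty\}$ if $|u(\gamma(0))-u(\gamma(l_\gamma))|\le\int_\gamma g\,ds$ for all curves $\gamma$, with the convention $|(\pm\infty)-(\pm\infty)|=\infty$. For $u\in\mathcal M(\mathcal P,\mu)$, $\|u\|_{N^1X}=\|u\|_X+\inf_g\|g\|_X$, the infimum being over all upper gradients $g$ of $u$; $N^1X=\{u\in\mathcal M(\mathcal P,\mu):\|u\|_{N^1X}<\infty\}$ (functions defined everywhere). Here $u^+=\max\{u,0\}$ and $u^-=\max\{-u,0\}$. *)

theory Defs
  imports "HOL-Analysis.Analysis"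
begin

(* The measure is not assumed to be complete; the measurable sets are those of M. *)
locale metric_measure_space = sigma_finite_measure M
  for M :: "'a::metric_space measure" +
  assumes space_UNIV: "space M = UNIV"
    and borel_measurable_sets: "sets borel \<subseteq> sets M"
    and borel_regular:
      "\<And>A. A \<in> sets M \<Longrightarrow> \<exists>D\<in>sets borel. A \<subseteq> D \<and> emeasure M D = emeasure M A"
    and ball_pos: "\<And>x r. 0 < r \<Longrightarrow> 0 < emeasure M (ball x r)"
    and ball_finite: "\<And>x r. 0 < r \<Longrightarrow> emeasure M (ball x r) < \<infinity>"

(* N is the functional on measurable functions and c the modulus of concavity; values of N
   at non-measurable functions are unconstrained.

   The conventions for the pointwise operations on extended reals are those of ereal
   (in particular \<infinity> + (-\<infinity>) = \<infinity>).  They do not affect the axioms: homogeneity,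
   lattice_mono and the first axiom force N u = \<infinity> unless u is finite a.e., so if N u and N v
   are finite, u + v is determined a.e. and hence so is N (u + v); if one of them is infinite,
   the quasi-triangle inequality is trivial.  Likewise the series in riesz_fischer is a
   series of nonnegative terms outside a null set.

   riesz_fischer is indexed from 0 instead of 1, whence the exponent Suc n. *)
locale quasi_banach_function_lattice = metric_measure_space M
  for M :: "'a::metric_space measure" +
  fixes N :: "('a \<Rightarrow> ereal) \<Rightarrow> ennreal" and c :: real
  assumes modulus_ge_1: "1 \<le> c"
    and norm_eq_0_iff:
      "\<And>u. u \<in> borel_measurable M \<Longrightarrow> N u = 0 \<longleftrightarrow> (AE x in M. u x = 0)"
    and norm_scale:
      "\<And>u a. u \<in> borel_measurable M \<Longrightarrow> N (\<lambda>x. ereal a * u x) = ennreal \<bar>a\<bar> * N u"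
    and quasi_triangle:
      "\<And>u v. u \<in> borel_measurable M \<Longrightarrow> v \<in> borel_measurable M \<Longrightarrow>
         N (\<lambda>x. u x + v x) \<le> ennreal c * (N u + N v)"
    and lattice_mono:
      "\<And>u v. u \<in> borel_measurable M \<Longrightarrow> v \<in> borel_measurable M \<Longrightarrow>
         (AE x in M. \<bar>u x\<bar> \<le> \<bar>v x\<bar>) \<Longrightarrow> N u \<le> N v"
    and riesz_fischer:
      "\<And>u :: nat \<Rightarrow> 'a \<Rightarrow> ereal.
         (\<And>n. u n \<in> borel_measurable M) \<Longrightarrow> (\<And>n. AE x in M. 0 \<le> u n x) \<Longrightarrow>
         N (\<lambda>x. \<Sum>n. u n x) \<le> (\<Sum>n. ennreal c ^ Suc n * N (u n))"
    and norm_continuous: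
      "\<And>(u :: nat \<Rightarrow> 'a \<Rightarrow> ereal) v.
         (\<And>n. u n \<in> borel_measurable M) \<Longrightarrow> v \<in> borel_measurable M \<Longrightarrow>
         (\<lambda>n. N (\<lambda>x. u n x - v x)) \<longlonglongrightarrow> 0 \<Longrightarrow> (\<lambda>n. N (u n)) \<longlonglongrightarrow> N v"

definition curve_length :: "real \<Rightarrow> real \<Rightarrow> (real \<Rightarrow> 'a::metric_space) \<Rightarrow> ennreal" where
  "curve_length a b \<gamma> =
     (SUP (n, t) \<in> {(n :: nat, t :: nat \<Rightarrow> real).
                      t 0 = a \<and> t n = b \<and> (\<forall>i<n. t i \<le> t (Suc i))}.
        \<Sum>i<n. ennreal (dist (\<gamma> (t i)) (\<gamma> (t (Suc i)))))"

(* A non-constant rectifiable continuous curve parametrized by arc length on {0..l}; the last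
   clause at t = l says that l is the length of the curve.  Values of \<gamma> outside {0..l} are
   irrelevant. *)
definition arc_length_curve :: "real \<Rightarrow> (real \<Rightarrow> 'a::metric_space) \<Rightarrow> bool" where
  "arc_length_curve l \<gamma> \<longleftrightarrow>
     continuous_on {0..l} \<gamma> \<and> \<not> \<gamma> constant_on {0..l} \<and> curve_length 0 l \<gamma> < \<infinity> \<and>
     (\<forall>t\<in>{0..l}. curve_length 0 t \<gamma> = ennreal t)"

(* The convention |\<plusminus>\<infinity> - (\<plusminus>\<infinity>)| = \<infinity> used for upper gradients is built into ereal. *)
lemma abs_diff_infinity_convention:
  "\<bar>(\<infinity>::ereal) - \<infinity>\<bar> = \<infinity>" "\<bar>- (\<infinity>::ereal) - (- \<infinity>)\<bar> = \<infinity>"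
  "\<bar>(\<infinity>::ereal) - (- \<infinity>)\<bar> = \<infinity>" "\<bar>- (\<infinity>::ereal) - \<infinity>\<bar> = \<infinity>"
  by simp_all

definition upper_gradient :: "('a::metric_space \<Rightarrow> ennreal) \<Rightarrow> ('a \<Rightarrow> ereal) \<Rightarrow> bool" where
  "upper_gradient g u \<longleftrightarrow>
     g \<in> borel_measurable borel \<and>
     (\<forall>l \<gamma>. arc_length_curve l \<gamma> \<longrightarrow>
        \<bar>u (\<gamma> 0) - u (\<gamma> l)\<bar> \<le> enn2ereal (\<integral>\<^sup>+t\<in>{0..l}. g (\<gamma> t) \<partial>lborel))"

definition newtonian_norm ::
    "(('a::metric_space \<Rightarrow> ereal) \<Rightarrow> ennreal) \<Rightarrow> ('a \<Rightarrow> ereal) \<Rightarrow> ennreal" where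
  "newtonian_norm N u = N u + (INF g \<in> {g. upper_gradient g u}. N (\<lambda>x. enn2ereal (g x)))"

definition newtonian_space ::
    "'a::metric_space measure \<Rightarrow> (('a \<Rightarrow> ereal) \<Rightarrow> ennreal) \<Rightarrow> ('a \<Rightarrow> ereal) set" where
  "newtonian_space M N = {u \<in> borel_measurable M. newtonian_norm N u < \<infinity>}"

end

theory Submission
  imports Defs
begin

(* All five functions w satisfy |w x| \<le> |u x| + |v x| and |w x - w y| \<le> |u x - u y| + |v x - v y|
   pointwise (taking v = u in the unary cases), so the sum of upper gradients of u and v is an
   upper gradient of w, and the quasi-triangle inequality bounds both parts of the norm. *)

text \<open>Additivity needs measurable integrands, but \<gamma> is continuous only on
  \<open>{a..b}\<close>, so \<open>g (\<gamma> t)\<close> need not be measurable on the whole line.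
  Cutting off with the indicator of \<open>{a..b}\<close> removes the uncontrolled values.\<close>

lemma set_nn_integral_add_along_continuous:
  fixes \<gamma> :: "real \<Rightarrow> 'a::metric_space"
  assumes \<gamma>: "continuous_on {a..b} \<gamma>"
    and g: "g \<in> borel_measurable borel" and h: "h \<in> borel_measurable borel"
  shows "(\<integral>\<^sup>+t\<in>{a..b}. (g (\<gamma> t) + h (\<gamma> t)) \<partial>lborel) =
         (\<integral>\<^sup>+t\<in>{a..b}. g (\<gamma> t) \<partial>lborel) + (\<integral>\<^sup>+t\<in>{a..b}. h (\<gamma> t) \<partial>lborel)"
proof -
  have meas: "(\<lambda>t. f (\<gamma> t) * indicator {a..b} t) \<in> borel_measurable lborel"
    if "f \<in> borel_measurable borel" for f :: "'a \<Rightarrow> ennreal"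
  proof -
    have "\<gamma> \<in> borel_measurable (restrict_space borel {a..b})"
      using \<gamma> by (rule borel_measurable_continuous_on_restrict)
    then have "(\<lambda>t. f (\<gamma> t)) \<in> borel_measurable (restrict_space borel {a..b})"
      using that by (rule measurable_compose)
    then show ?thesis
      \<comment> \<open>Measurability on the restricted space is the same as measurability of the
        product with the indicator.\<close>
      by (subst (asm) borel_measurable_restrict_space_iff_ennreal) auto
  qed
  show ?thesis
    using nn_integral_add[OF meas[OF g] meas[OF h]] by (simp add: distrib_right)
qed

lemma upper_gradient_add_dominated:
  assumes g: "upper_gradient g u" and h: "upper_gradient h v"
    and le: "\<And>x y. \<bar>w x - w y\<bar> \<le> \<bar>u x - u y\<bar> + \<bar>v x - v y\<bar>"
  shows "upper_gradient (\<lambda>x. g x + h x) w"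
  unfolding upper_gradient_def
proof (intro conjI allI impI)
  have meas: "g \<in> borel_measurable borel" "h \<in> borel_measurable borel"
    using g h by (auto simp: upper_gradient_def)
  then show "(\<lambda>x. g x + h x) \<in> borel_measurable borel"
    by simp
  fix l :: real and \<gamma> :: "real \<Rightarrow> 'a"
  assume \<gamma>: "arc_length_curve l \<gamma>"
  then have cont: "continuous_on {0..l} \<gamma>"
    by (simp add: arc_length_curve_def)
  have "\<bar>w (\<gamma> 0) - w (\<gamma> l)\<bar> \<le> \<bar>u (\<gamma> 0) - u (\<gamma> l)\<bar> + \<bar>v (\<gamma> 0) - v (\<gamma> l)\<bar>"
    by (rule le)
  also have "\<dots> \<le> enn2ereal (\<integral>\<^sup>+t\<in>{0..l}. g (\<gamma> t) \<partial>lborel) + enn2ereal (\<integral>\<^sup>+t\<in>{0..l}. h (\<gamma> t) \<partial>lborel)"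
    using g h \<gamma> by (intro add_mono) (auto simp: upper_gradient_def)
  also have "\<dots> = enn2ereal (\<integral>\<^sup>+t\<in>{0..l}. (g (\<gamma> t) + h (\<gamma> t)) \<partial>lborel)"
    by (simp add: set_nn_integral_add_along_continuous[OF cont meas] plus_ennreal.rep_eq)
  finally show "\<bar>w (\<gamma> 0) - w (\<gamma> l)\<bar> \<le> enn2ereal (\<integral>\<^sup>+t\<in>{0..l}. (g (\<gamma> t) + h (\<gamma> t)) \<partial>lborel)" .
qed

text \<open>An infimum in \<open>ennreal\<close> is below \<infinity> iff some member is, and the
  infimum over the empty set is \<infinity>. Hence membership needs only one upper gradient with
  finite \<open>N\<close>, not a minimal one.\<close>

lemma newtonian_space_iff:
  "u \<in> newtonian_space M N \<longleftrightarrow>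
     u \<in> borel_measurable M \<and> N u < \<infinity> \<and> (\<exists>g. upper_gradient g u \<and> N (\<lambda>x. enn2ereal (g x)) < \<infinity>)"
  by (auto simp: newtonian_space_def newtonian_norm_def INF_less_iff)

context quasi_banach_function_lattice
begin

text \<open>The quasi-triangle inequality is applied to the absolute values, because their sum,
  unlike u + v, dominates w. Replacing a function by its absolute value does not increase
  \<open>N\<close>, by \<open>lattice_mono\<close>.\<close>

lemma norm_dominated_finite:
  assumes "u \<in> borel_measurable M" "v \<in> borel_measurable M" "w \<in> borel_measurable M"
    and "\<And>x. \<bar>w x\<bar> \<le> \<bar>u x\<bar> + \<bar>v x\<bar>"
    and "N u < \<infinity>" "N v < \<infinity>"
  shows "N w < \<infinity>"
proof -
  have abs: "N (\<lambda>x. \<bar>f x\<bar>) \<le> N f" if "f \<in> borel_measurable M" for f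
    using that by (intro lattice_mono) auto
  have "N w \<le> N (\<lambda>x. \<bar>u x\<bar> + \<bar>v x\<bar>)"
    using assms by (intro lattice_mono) auto
  also have "\<dots> \<le> ennreal c * (N (\<lambda>x. \<bar>u x\<bar>) + N (\<lambda>x. \<bar>v x\<bar>))"
    using assms by (intro quasi_triangle) auto
  also have "\<dots> \<le> ennreal c * (N u + N v)"
    using assms by (intro mult_left_mono add_mono abs) auto
  also have "\<dots> < \<infinity>"
    using assms by (simp add: ennreal_mult_less_top)
  finally show ?thesis .
qed

lemma newtonian_space_dominated:
  assumes u: "u \<in> newtonian_space M N" and v: "v \<in> newtonian_space M N"
    and w: "w \<in> borel_measurable M"
    and bound: "\<And>x. \<bar>w x\<bar> \<le> \<bar>u x\<bar> + \<bar>v x\<bar>"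
    and diff: "\<And>x y. \<bar>w x - w y\<bar> \<le> \<bar>u x - u y\<bar> + \<bar>v x - v y\<bar>"
  shows "w \<in> newtonian_space M N"
proof -
  obtain g h where g: "upper_gradient g u" "N (\<lambda>x. enn2ereal (g x)) < \<infinity>"
    and h: "upper_gradient h v" "N (\<lambda>x. enn2ereal (h x)) < \<infinity>"
    using u v by (auto simp: newtonian_space_iff)
  have gh: "upper_gradient (\<lambda>x. g x + h x) w"
    using g(1) h(1) diff by (rule upper_gradient_add_dominated)
  \<comment> \<open>Upper gradients are Borel functions, whereas the axioms for \<open>N\<close>
    concern M-measurable ones; \<open>borel_measurable_sets\<close> bridges the two.\<close>
  have meas: "(\<lambda>x. enn2ereal (f x)) \<in> borel_measurable M" if "upper_gradient f k" for f k
  proof -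
    have "f \<in> borel_measurable borel"
      using that by (simp add: upper_gradient_def)
    then have "f \<in> borel_measurable M"
      using borel_measurable_sets space_UNIV by (auto simp: measurable_def)
    then show ?thesis
      by simp
  qed
  \<comment> \<open>The domination lemma is used with g + h itself as the dominated
    function.\<close>
  have "N (\<lambda>x. enn2ereal (g x + h x)) < \<infinity>"
    by (rule norm_dominated_finite[OF meas[OF g(1)] meas[OF h(1)] meas[OF gh] _ g(2) h(2)])
      (simp add: plus_ennreal.rep_eq)
  moreover have "N w < \<infinity>"
    using u v w bound by (intro norm_dominated_finite[of u v w]) (auto simp: newtonian_space_iff)
  ultimately show ?thesis
    using w gh unfolding newtonian_space_iff by blast
qed

end

text \<open>The unary bounds carry \<open>\<bar>a\<bar>\<close> twice so that they match the
  hypothesis \<open>bound\<close> of \<open>newtonian_space_dominated\<close> with both given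
  functions equal.\<close>

lemma ereal_lattice_bounds:
  fixes a b :: ereal
  shows "\<bar>max a b\<bar> \<le> \<bar>a\<bar> + \<bar>b\<bar>" "\<bar>min a b\<bar> \<le> \<bar>a\<bar> + \<bar>b\<bar>"
    "\<bar>\<bar>a\<bar>\<bar> \<le> \<bar>a\<bar> + \<bar>a\<bar>" "\<bar>max a 0\<bar> \<le> \<bar>a\<bar> + \<bar>a\<bar>" "\<bar>max (- a) 0\<bar> \<le> \<bar>a\<bar> + \<bar>a\<bar>"
proof -
  show "\<bar>max a b\<bar> \<le> \<bar>a\<bar> + \<bar>b\<bar>" "\<bar>min a b\<bar> \<le> \<bar>a\<bar> + \<bar>b\<bar>"
    by (cases a; cases b; simp add: max_def min_def)+
  show "\<bar>\<bar>a\<bar>\<bar> \<le> \<bar>a\<bar> + \<bar>a\<bar>" "\<bar>max a 0\<bar> \<le> \<bar>a\<bar> + \<bar>a\<bar>" "\<bar>max (- a) 0\<bar> \<le> \<bar>a\<bar> + \<bar>a\<bar>"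
    by (cases a; simp add: max_def)+
qed

lemma ereal_lattice_diff_bounds:
  fixes a b a' b' :: ereal
  shows "\<bar>max a b - max a' b'\<bar> \<le> \<bar>a - a'\<bar> + \<bar>b - b'\<bar>"
    "\<bar>min a b - min a' b'\<bar> \<le> \<bar>a - a'\<bar> + \<bar>b - b'\<bar>"
    "\<bar>\<bar>a\<bar> - \<bar>a'\<bar>\<bar> \<le> \<bar>a - a'\<bar> + \<bar>a - a'\<bar>"
    "\<bar>max a 0 - max a' 0\<bar> \<le> \<bar>a - a'\<bar> + \<bar>a - a'\<bar>"
    "\<bar>max (- a) 0 - max (- a') 0\<bar> \<le> \<bar>a - a'\<bar> + \<bar>a - a'\<bar>"
proof -
  (* If some argument is infinite, the right-hand side is infinite, as |\<infinity> - \<infinity>| = \<infinity> on ereal. *)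
  have infinite: "\<bar>x - y\<bar> = \<infinity>" if "\<bar>x\<bar> = \<infinity> \<or> \<bar>y\<bar> = \<infinity>" for x y :: ereal
    using that by (cases x; cases y; simp)
  have real: "\<bar>max p q - max p' q'\<bar> \<le> \<bar>p - p'\<bar> + \<bar>q - q'\<bar>"
    "\<bar>min p q - min p' q'\<bar> \<le> \<bar>p - p'\<bar> + \<bar>q - q'\<bar>" for p q p' q' :: real
    by linarith+
  \<comment> \<open>Either all four arguments are real, and the real inequalities transfer through
    \<open>ereal\<close>, or the bound is trivial.\<close>
  have finite: "(\<exists>p p' q q'. a = ereal p \<and> a' = ereal p' \<and> b = ereal q \<and> b' = ereal q') \<or>
      \<bar>a - a'\<bar> + \<bar>b - b'\<bar> = \<infinity>"
    using infinite[of a a'] infinite[of b b'] by (cases a; cases a'; cases b; cases b') simp_all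
  then show "\<bar>max a b - max a' b'\<bar> \<le> \<bar>a - a'\<bar> + \<bar>b - b'\<bar>"
    "\<bar>min a b - min a' b'\<bar> \<le> \<bar>a - a'\<bar> + \<bar>b - b'\<bar>"
    by (elim disjE exE conjE; simp add: real flip: ereal_max ereal_min)+
  \<comment> \<open>The unary claims need their own dichotomy: an infinite b or b' would say nothing
    about \<open>\<bar>a - a'\<bar>\<close>.\<close>
  have "(\<exists>p p'. a = ereal p \<and> a' = ereal p') \<or> \<bar>a - a'\<bar> = \<infinity>"
    using infinite[of a a'] by (cases a; cases a') simp_all
  then show "\<bar>\<bar>a\<bar> - \<bar>a'\<bar>\<bar> \<le> \<bar>a - a'\<bar> + \<bar>a - a'\<bar>"
    "\<bar>max a 0 - max a' 0\<bar> \<le> \<bar>a - a'\<bar> + \<bar>a - a'\<bar>"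
    "\<bar>max (- a) 0 - max (- a') 0\<bar> \<le> \<bar>a - a'\<bar> + \<bar>a - a'\<bar>"
    by (elim disjE exE conjE; force simp: zero_ereal_def max_def abs_if)+
qed

theorem theorem2p9:
  fixes M :: "'a::metric_space measure"
    and N :: "('a \<Rightarrow> ereal) \<Rightarrow> ennreal"
    and c :: real
    and u v :: "'a \<Rightarrow> ereal"
  assumes "quasi_banach_function_lattice M N c"
    and "u \<in> newtonian_space M N"
    and "v \<in> newtonian_space M N"
  shows "(\<lambda>x. max (u x) (v x)) \<in> newtonian_space M N \<and>
         (\<lambda>x. min (u x) (v x)) \<in> newtonian_space M N \<and>
         (\<lambda>x. \<bar>u x\<bar>) \<in> newtonian_space M N \<and>
         (\<lambda>x. max (u x) 0) \<in> newtonian_space M N \<and>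
         (\<lambda>x. max (- u x) 0) \<in> newtonian_space M N"
proof -
  interpret quasi_banach_function_lattice M N c
    by fact
  have [measurable]: "u \<in> borel_measurable M" "v \<in> borel_measurable M"
    using assms by (auto simp: newtonian_space_iff)
  note uv = newtonian_space_dominated[OF assms(2,3)] and uu = newtonian_space_dominated[OF assms(2,2)]
  show ?thesis
    \<comment> \<open>Here \<open>uv\<close> serves max and min, and \<open>uu\<close> the three
      functions built from u alone; only measurability remains.\<close>
    by (intro conjI uv uu ereal_lattice_bounds ereal_lattice_diff_bounds) measurable
qed

end
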